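(* Let $G$ be a non-trivial periodic group with set of minimal subgroups $\Omega_G=\{H_i\}_{i\in I}$, such that $H_iH_j=H_jH_i$ for all $H_i,H_j\in\Omega_G$ and $|\Omega_G|\ge2$. Let $H_r\in\Omega_G$. If $G$ is not a $p$-group for any prime $p$ and $H\in V_{H_r}$ with $|H|\ne|H_r|$, then $(H_i,H)\in E_{H_r}$ for all $H_i\in V_{H_r}$ with $H_i\ne H$, and $|J|=1$.
   Context: Minimal subgroup means minimal non-trivial subgroup. $\Gamma(H_r)$ is the simple graph with vertex set $V_{H_r}=\Omega_G\setminus\{H_r\}$ and edge set $E_{H_r}=\{(H_i,H_j)\mid H_i\ne H_j,\ H_iH_j\cap H_r=1\}$ (with $H_i,H_j\in V_{H_r}$). $\{\Gamma_j\}_{j\in J}$ denotes the set of all connected components of $\Gamma(H_r)$, so $|J|$ is the number of connected components. Groups may be infinite; a $p$-group is a group in which every element has order a power of $p$. *)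

theory Defs
  imports "HOL-Algebra.Multiplicative_Group" "HOL-Computational_Algebra.Primes" "Graph_Theory.Digraph_Component"
begin

definition periodic_group :: "('a, 'b) monoid_scheme \<Rightarrow> bool" where
  "periodic_group G \<longleftrightarrow>
     group G \<and> (\<forall>x\<in>carrier G. \<exists>n::nat. 0 < n \<and> x [^]\<^bsub>G\<^esub> n = \<one>\<^bsub>G\<^esub>)"

(* group.ord is 0 exactly on the elements of infinite order, so the condition below
   also forces every element to have finite order when p is prime. *)
definition p_group :: "nat \<Rightarrow> ('a, 'b) monoid_scheme \<Rightarrow> bool" where
  "p_group p G \<longleftrightarrow> group G \<and> (\<forall>x\<in>carrier G. \<exists>k::nat. group.ord G x = p ^ k)"

definition minimal_subgroup :: "'a set \<Rightarrow> ('a, 'b) monoid_scheme \<Rightarrow> bool" where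
  "minimal_subgroup H G \<longleftrightarrow>
     subgroup H G \<and> H \<noteq> {\<one>\<^bsub>G\<^esub>} \<and>
     (\<forall>K. subgroup K G \<longrightarrow> K \<subseteq> H \<longrightarrow> K = {\<one>\<^bsub>G\<^esub>} \<or> K = H)"

definition minimal_subgroups :: "('a, 'b) monoid_scheme \<Rightarrow> 'a set set" where
  "minimal_subgroups G = {H. minimal_subgroup H G}"

(* An undirected edge is represented by its two orientations; see Gamma_simple below. *)
definition Gamma :: "('a, 'b) monoid_scheme \<Rightarrow> 'a set \<Rightarrow> 'a set pair_pre_digraph" where
  "Gamma G Hr =
     \<lparr> pverts = minimal_subgroups G - {Hr},
       parcs = {(Hi, Hj). Hi \<in> minimal_subgroups G - {Hr} \<and> Hj \<in> minimal_subgroups G - {Hr} \<and>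
                          Hi \<noteq> Hj \<and> (Hi <#>\<^bsub>G\<^esub> Hj) \<inter> Hr = {\<one>\<^bsub>G\<^esub>}} \<rparr>"

lemma Gamma_simple:
  assumes "\<And>Hi Hj. Hi \<in> minimal_subgroups G \<Longrightarrow> Hj \<in> minimal_subgroups G \<Longrightarrow>
             Hi <#>\<^bsub>G\<^esub> Hj = Hj <#>\<^bsub>G\<^esub> Hi"
  shows "pair_bidirected_digraph (Gamma G Hr)"
  by unfold_locales (use assms in \<open>auto simp: Gamma_def symmetric_def sym_def\<close>)

(* The connected components as maximal connected subgraphs; the predicate
   Digraph_Component.connected refers to the underlying undirected graph and requires a
   nonempty vertex set. *)
definition connected_components :: "('a, 'b) pre_digraph \<Rightarrow> ('a, 'b) pre_digraph set" where
  "connected_components X = {C. pre_digraph.max_subgraph X Digraph_Component.connected C}"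

end

theory Submission
  imports Defs
begin

text \<open>
  Suppose $H_iH$ meets $H_r$ in some $x \ne 1$, and write $x = ab$ with $a \in H_i$ and $b \in H$.
  Then $b = a^{-1}x$ is a non-trivial element of $H \cap H_iH_r$, so minimality of $H$ and of $H_r$
  gives $H_iH = H_iH_r$. Since $H_i$ meets both $H$ and $H_r$ trivially, each of these is a
  transversal of the cosets of $H_i$ in this subgroup, and so $|H| = |H_r|$. Hence, if
  $|H| \ne |H_r|$, every other vertex is adjacent to $H$, and $\Gamma(H_r)$ contains a spanning star.
\<close>

context group
begin

text \<open>The intersection of \<open>H\<close> and \<open>K\<close> is a subgroup inside
  \<open>H\<close>, and \<open>x\<close> keeps it from being trivial, so minimality makes it all of
  \<open>H\<close>.\<close>

lemma minimal_subgroup_subset: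
  assumes "minimal_subgroup H G" "subgroup K G" "x \<in> H" "x \<in> K" "x \<noteq> \<one>"
  shows "H \<subseteq> K"
proof -
  have "subgroup (H \<inter> K) G"
    using assms(1,2) by (auto simp: minimal_subgroup_def intro: subgroups_Inter_pair)
  then have "H \<inter> K = {\<one>} \<or> H \<inter> K = H"
    using assms(1) unfolding minimal_subgroup_def by blast
  then show ?thesis using assms(3-5) by blast
qed

lemma minimal_subgroup_inter:
  assumes "minimal_subgroup H G" "minimal_subgroup K G" "H \<noteq> K"
  shows "H \<inter> K = {\<one>}"
proof -
  have H: "subgroup H G" and K: "subgroup K G"
    using assms(1,2) by (auto simp: minimal_subgroup_def)
  then have "\<one> \<in> H \<inter> K" by (simp add: subgroup.one_closed)
  moreover have "x = \<one>" if "x \<in> H \<inter> K" for x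
    using minimal_subgroup_subset[OF assms(1) K, of x]
      minimal_subgroup_subset[OF assms(2) H, of x] that assms(3) by blast
  ultimately show ?thesis by blast
qed

text \<open>An equality of cosets puts \<open>x \<otimes> inv y\<close> into the trivial
  \<open>K \<inter> H\<close>.\<close>

lemma inj_on_r_coset:
  assumes "subgroup K G" "subgroup H G" "K \<inter> H = {\<one>}"
  shows "inj_on ((#>) K) H"
proof (rule inj_onI)
  fix x y assume xy: "x \<in> H" "y \<in> H" "K #> x = K #> y"
  have G: "x \<in> carrier G" "y \<in> carrier G"
    using xy assms(2) by (auto dest: subgroup.mem_carrier)
  have "K #> (x \<otimes> inv y) = K"
    using coset_mult_inv2[OF xy(3) G] assms(1) by (simp add: subgroup.subset)
  then have "x \<otimes> inv y \<in> K" by (rule coset_join1) (simp_all add: G assms(1))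
  moreover have "x \<otimes> inv y \<in> H"
    using xy assms(2) by (simp add: subgroup.m_closed subgroup.m_inv_closed)
  ultimately have "x \<otimes> inv y = \<one>" using assms(3) by blast
  then show "x = y" using G inv_solve_right'[of \<one> x y] by simp
qed

text \<open>In \<open>x = k \<otimes> l\<close> the factor \<open>k\<close> is absorbed by
  \<open>K\<close>, so \<open>x\<close> and \<open>l\<close> represent the same right coset.\<close>

lemma r_coset_image_subset:
  assumes "subgroup K G" "H \<subseteq> K <#> L" "L \<subseteq> carrier G"
  shows "(#>) K ` H \<subseteq> (#>) K ` L"
proof
  fix C assume "C \<in> (#>) K ` H"
  then obtain x where x: "x \<in> H" "C = K #> x" by blast
  then obtain k l where kl: "k \<in> K" "l \<in> L" "x = k \<otimes> l"
    using assms(2) unfolding set_mult_def by blast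
  then have "x \<in> K #> l" unfolding r_coset_def by blast
  then have "K #> l = K #> x" using kl assms by (intro repr_independence) auto
  then show "C \<in> (#>) K ` L" using x kl by blast
qed

lemma subset_set_mult_right:
  assumes "subgroup K G" "H \<subseteq> carrier G"
  shows "H \<subseteq> K <#> H"
proof
  fix x assume "x \<in> H"
  then have "\<one> \<otimes> x \<in> K <#> H"
    using assms(1) unfolding set_mult_def by (blast dest: subgroup.one_closed)
  then show "x \<in> K <#> H" using \<open>x \<in> H\<close> assms(2) by auto
qed

text \<open>\<open>H\<close> and \<open>L\<close> represent the same right cosets of
  \<open>K\<close>, each coset once. Since \<open>card_image\<close> asks only for injectivity,
  infinite sets, whose \<open>card\<close> is 0, are covered too.\<close>

lemma card_eq_of_complements:
  assumes "subgroup K G" "subgroup H G" "subgroup L G"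
    and "K \<inter> H = {\<one>}" "K \<inter> L = {\<one>}" and "H \<subseteq> K <#> L" "L \<subseteq> K <#> H"
  shows "card H = card L"
proof -
  have "(#>) K ` H = (#>) K ` L"
    using r_coset_image_subset assms subgroup.subset by (metis subset_antisym)
  then show ?thesis
    using inj_on_r_coset assms(1-5) by (metis card_image)
qed

text \<open>Commutation enters twice: inversion sends \<open>h \<otimes> k\<close> into
  \<open>K <#> H\<close>, and in the product of \<open>H <#> K\<close> with itself the inner
  \<open>K <#> H\<close> is swapped, which collects the two copies of each factor.\<close>

lemma subgroup_set_mult_commuting:
  assumes H: "subgroup H G" and K: "subgroup K G" and comm: "H <#> K = K <#> H"
  shows "subgroup (H <#> K) G"
proof (rule subgroupI)
  note carr = subgroup.mem_carrier[OF H] subgroup.mem_carrier[OF K]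
  note sub = subgroup.subset[OF H] subgroup.subset[OF K]
  show "H <#> K \<subseteq> carrier G" using sub by (rule set_mult_closed)
  show "H <#> K \<noteq> {}"
    using subset_set_mult_right[OF H sub(2)] subgroup.one_closed[OF K] by blast
  show "inv x \<in> H <#> K" if x: "x \<in> H <#> K" for x
  proof -
    obtain h k where hk: "h \<in> H" "k \<in> K" "x = h \<otimes> k"
      using x unfolding set_mult_def by blast
    then have "inv x = inv k \<otimes> inv h" using carr by (simp add: inv_mult_group)
    then have "inv x \<in> K <#> H"
      using hk subgroup.m_inv_closed[OF H] subgroup.m_inv_closed[OF K]
      unfolding set_mult_def by blast
    then show ?thesis using comm by simp
  qed
  have "(H <#> K) <#> (H <#> K) = H <#> (K <#> H) <#> K"
    using sub by (simp add: set_mult_assoc set_mult_closed)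
  also have "\<dots> = (H <#> H) <#> (K <#> K)"
    using sub by (simp add: comm[symmetric] set_mult_assoc set_mult_closed)
  also have "\<dots> = H <#> K" using H K by (simp add: subgroup_mult_id)
  finally have closed: "(H <#> K) <#> (H <#> K) = H <#> K" .
  show "x \<otimes> y \<in> H <#> K" if "x \<in> H <#> K" "y \<in> H <#> K" for x y
  proof -
    have "x \<otimes> y \<in> (H <#> K) <#> (H <#> K)" using that by (auto simp: set_mult_def)
    then show ?thesis by (simp add: closed)
  qed
qed

text \<open>\<open>K\<close>, \<open>H\<close> and \<open>L\<close> play the roles of
  \<open>Hi\<close>, \<open>H\<close> and \<open>Hr\<close>. The two commutations make
  \<open>K <#> H\<close> and \<open>K <#> L\<close> subgroups, against which the minimality of
  \<open>L\<close> and of \<open>H\<close> can be applied.\<close>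

lemma minimal_subgroup_set_mult_inter:
  assumes K: "minimal_subgroup K G" and H: "minimal_subgroup H G" and L: "minimal_subgroup L G"
    and comm: "K <#> H = H <#> K" "K <#> L = L <#> K"
    and neq: "K \<noteq> H" "K \<noteq> L" and card: "card H \<noteq> card L"
  shows "(K <#> H) \<inter> L = {\<one>}"
proof -
  have subgroups: "subgroup K G" "subgroup H G" "subgroup L G"
    using K H L by (auto simp: minimal_subgroup_def)
  note carr = subgroups[THEN subgroup.mem_carrier]
  have KH: "subgroup (K <#> H) G" and KL: "subgroup (K <#> L) G"
    using subgroups comm by (auto intro: subgroup_set_mult_commuting)
  have triv: "K \<inter> H = {\<one>}" "K \<inter> L = {\<one>}"
    using minimal_subgroup_inter K H L neq by auto
  have "x = \<one>" if x: "x \<in> K <#> H" "x \<in> L" for x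
  proof (rule ccontr)
    assume "x \<noteq> \<one>"
    obtain a b where ab: "a \<in> K" "b \<in> H" "x = a \<otimes> b"
      using x(1) unfolding set_mult_def by blast
    \<comment> \<open>Otherwise \<open>x\<close> equals \<open>a\<close> and lies in the trivial
      \<open>K \<inter> L\<close>.\<close>
    have "b \<noteq> \<one>"
    proof
      assume "b = \<one>"
      then have "x \<in> K \<inter> L" using ab x(2) carr by simp
      then show False using triv \<open>x \<noteq> \<one>\<close> by blast
    qed
    \<comment> \<open>Solving for \<open>b\<close> exhibits it as an element of
      \<open>K <#> L\<close>; being non-trivial, it brings all of \<open>H\<close> with it.\<close>
    have "b = inv a \<otimes> x"
      using ab carr by (simp add: inv_solve_left)
    then have "b \<in> K <#> L"
      using ab(1) x(2) subgroups(1) unfolding set_mult_def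
      by (blast dest: subgroup.m_inv_closed)
    then have "H \<subseteq> K <#> L"
      using minimal_subgroup_subset[OF H KL] ab(2) \<open>b \<noteq> \<one>\<close> by blast
    moreover have "L \<subseteq> K <#> H"
      using minimal_subgroup_subset[OF L KH] x \<open>x \<noteq> \<one>\<close> by blast
    ultimately show False
      using card card_eq_of_complements subgroups triv by blast
  qed
  moreover have "\<one> \<in> K <#> H" "\<one> \<in> L"
    using KH subgroups(3) by (auto dest: subgroup.one_closed)
  ultimately show ?thesis by blast
qed

end

text \<open>Any two vertices are joined by a walk through \<open>c\<close> in the symmetric closure,
  and \<open>c\<close> itself shows that the vertex set is nonempty.\<close>

lemma connected_star:
  assumes "c \<in> verts X" "\<And>v. v \<in> verts X \<Longrightarrow> v \<noteq> c \<Longrightarrow> (v, c) \<in> arcs_ends X"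
  shows "Digraph_Component.connected X"
proof -
  let ?R = "rtrancl_on (verts X) ((arcs_ends X)\<^sup>s)"
  have "(v, c) \<in> ?R \<and> (c, v) \<in> ?R" if "v \<in> verts X" for v
  proof (cases "v = c")
    case True
    then show ?thesis using assms(1) by simp
  next
    case False
    then have "(v, c) \<in> (arcs_ends X)\<^sup>s" "(c, v) \<in> (arcs_ends X)\<^sup>s"
      using assms(2)[OF that] by (auto simp: symcl_def image_iff intro: rev_bexI)
    then show ?thesis using that assms(1) by (auto intro: rtrancl_on_into_rtrancl_on)
  qed
  then show ?thesis
    unfolding connected_conv using assms(1) by (blast intro: rtrancl_on_trans)
qed

text \<open>Every subgraph of \<open>X\<close> lies below \<open>X\<close>, which is itself
  connected, so only \<open>X\<close> can be maximal.\<close>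

lemma connected_components_connected:
  assumes "wf_digraph X" "Digraph_Component.connected X"
  shows "connected_components X = {X}"
proof -
  have "subgraph X X" using assms(1) by (simp add: subgraph_def compatible_def)
  \<comment> \<open>Antisymmetry as equality of records: mutual inclusion gives the same vertices
    and arcs, compatibility the same \<open>tail\<close> and \<open>head\<close>.\<close>
  moreover have "Y = X" if "subgraph X Y" "subgraph Y X" for Y
    using that by (auto simp: subgraph_def compatible_def intro!: pre_digraph.equality)
  ultimately have "pre_digraph.max_subgraph X Digraph_Component.connected Y \<longleftrightarrow> Y = X" for Y
    using assms(2) unfolding pre_digraph.max_subgraph_def by metis
  then show ?thesis unfolding connected_components_def by blast
qed

theorem theorem3p8:
  fixes G :: "('a, 'b) monoid_scheme" and Hr H :: "'a set"
  assumes "periodic_group G"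
    and "carrier G \<noteq> {\<one>\<^bsub>G\<^esub>}"
    and "\<forall>Hi\<in>minimal_subgroups G. \<forall>Hj\<in>minimal_subgroups G.
           Hi <#>\<^bsub>G\<^esub> Hj = Hj <#>\<^bsub>G\<^esub> Hi"
    and "infinite (minimal_subgroups G) \<or> 2 \<le> card (minimal_subgroups G)"
    and "Hr \<in> minimal_subgroups G"
    and "\<not> (\<exists>p::nat. prime p \<and> p_group p G)"
    and "H \<in> pverts (Gamma G Hr)"
    and "card H \<noteq> card Hr"
  shows "(\<forall>Hi\<in>pverts (Gamma G Hr). Hi \<noteq> H \<longrightarrow> (Hi, H) \<in> parcs (Gamma G Hr)) \<and>
         card (connected_components (with_proj (Gamma G Hr))) = 1"
proof -
  interpret group G using assms(1) by (simp add: periodic_group_def)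
  have star: "(Hi, H) \<in> parcs (Gamma G Hr)" if "Hi \<in> pverts (Gamma G Hr)" "Hi \<noteq> H" for Hi
    using that assms(3,5,7,8) minimal_subgroup_set_mult_inter[of Hi H Hr]
    by (simp add: Gamma_def minimal_subgroups_def)
  interpret pair_bidirected_digraph "Gamma G Hr"
    using assms(3) by (blast intro: Gamma_simple)
  \<comment> \<open>The star has centre \<open>H\<close>. Under \<open>with_proj\<close> an arc is
    its own pair of ends, so membership in \<open>parcs\<close> gives membership in
    \<open>arcs_ends\<close>.\<close>
  have "Digraph_Component.connected (with_proj (Gamma G Hr))"
    using assms(7) star by (intro connected_star[of H]) auto
  then have "connected_components (with_proj (Gamma G Hr)) = {with_proj (Gamma G Hr)}"
    by (rule connected_components_connected[OF wf_digraph_axioms])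
  then show ?thesis using star by simp
qed

end
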